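(* Let $u\colon\mathbb{R}^3\to\mathbb{R}$ have octonion Fourier transform $U$. Let $U^{\partial x_1}$, $U^{\partial x_2}$ and $U^{\partial x_3}$ denote the octonion Fourier transforms of the partial derivatives $u_{x_1}$, $u_{x_2}$ and $u_{x_3}$, respectively. Then for all $(f_1,f_2,f_3)\in\mathbb{R}^3$ $$\begin{aligned} U^{\partial x_1}(f_1,f_2,f_3)&=U(f_1,-f_2,-f_3)\cdot(2\pi f_1\mathbf{e}_1), \\ U^{\partial x_2}(f_1,f_2,f_3)&=U(f_1,f_2,-f_3)\cdot(2\pi f_2\mathbf{e}_2), \\ U^{\partial x_3}(f_1,f_2,f_3)&=U(f_1,f_2,f_3)\cdot(2\pi f_3\mathbf{e}_4).\end{aligned}$$
   Context: $\mathbb{O}$ denotes the real algebra of octonions with basis $1,\mathbf{e}_1,\dots,\mathbf{e}_7$: an octonion is a pair $(q_0,q_1)$ of quaternions (quaternion units $\mathbf{e}_1,\mathbf{e}_2,\mathbf{e}_3$ with $\mathbf{e}_1\mathbf{e}_2=\mathbf{e}_3$), with product $(q_0,q_1)\cdot(p_0,p_1)=(q_0p_0-p_1^*q_1,\;p_1q_0+q_1p_0^* )$, where $^*$ is quaternion conjugation, and $\mathbf{e}_4=(0,1)$, $\mathbf{e}_5=(0,\mathbf{e}_1)$, $\mathbf{e}_6=(0,\mathbf{e}_2)$, $\mathbf{e}_7=(0,\mathbf{e}_3)$. The product is neither commutative nor associative; products without brackets are evaluated from left to right, i.e. $abcd=((ab)c)d$. For an imaginary unit $\mathbf{e}_k$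 and $\alpha\in\mathbb{R}$, $e^{\mathbf{e}_k\alpha}=\cos\alpha+\mathbf{e}_k\sin\alpha$. Integrals of octonion-valued functions are taken componentwise. The octonion Fourier transform (OFT) of a Lebesgue integrable $u\colon\mathbb{R}^3\to\mathbb{O}$ is $$U(\mathbf{f})=\int_{\mathbb{R}^3}u(\mathbf{x})\,e^{-\mathbf{e}_1 2\pi f_1x_1}\,e^{-\mathbf{e}_2 2\pi f_2x_2}\,e^{-\mathbf{e}_4 2\pi f_3x_3}\,d\mathbf{x},\qquad \mathbf{f}=(f_1,f_2,f_3)\in\mathbb{R}^3,$$ with multiplication from left to right. Standing assumptions: $u$ is real-valued and Lebesgue integrable, the partial derivatives in question exist (everywhere on $\mathbb{R}^3$), and they are Lebesgue integrable, so that their OFTs exist. *)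

theory Defs
  imports "HOL-Analysis.Analysis"
begin

text \<open>Nested products inherit addition, scaling and the Euclidean structure from the library;
  only the two multiplications have to be added. Products have no library multiplication, so
  there is no clash.\<close>

type_synonym quat = "real \<times> real \<times> real \<times> real"
type_synonym oct = "quat \<times> quat"

fun quat_mult :: "quat \<Rightarrow> quat \<Rightarrow> quat" where
  "quat_mult (a0, a1, a2, a3) (b0, b1, b2, b3) =
    (a0 * b0 - a1 * b1 - a2 * b2 - a3 * b3,
     a0 * b1 + a1 * b0 + a2 * b3 - a3 * b2,
     a0 * b2 - a1 * b3 + a2 * b0 + a3 * b1,
     a0 * b3 + a1 * b2 - a2 * b1 + a3 * b0)"

fun quat_cnj :: "quat \<Rightarrow> quat" where
  "quat_cnj (a0, a1, a2, a3) = (a0, - a1, - a2, - a3)"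

text \<open>Cayley--Dickson product. It is not associative; the left-associative infix gives the
  convention that unbracketed products are evaluated from left to right.\<close>

fun oct_mult :: "oct \<Rightarrow> oct \<Rightarrow> oct" (infixl \<open>\<odot>\<close> 70) where
  "(q0, q1) \<odot> (p0, p1) =
    (quat_mult q0 p0 - quat_mult (quat_cnj p1) q1,
     quat_mult p1 q0 + quat_mult q1 (quat_cnj p0))"

definition oct_of_real :: "real \<Rightarrow> oct" where
  "oct_of_real r = ((r, 0, 0, 0), 0)"

definition oct_e1 :: oct (\<open>\<^bold>e\<^sub>1\<close>) where
  "\<^bold>e\<^sub>1 = ((0, 1, 0, 0), 0)"

definition oct_e2 :: oct (\<open>\<^bold>e\<^sub>2\<close>) where
  "\<^bold>e\<^sub>2 = ((0, 0, 1, 0), 0)"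

definition oct_e4 :: oct (\<open>\<^bold>e\<^sub>4\<close>) where
  "\<^bold>e\<^sub>4 = (0, (1, 0, 0, 0))"

lemma quat_mult_units:
  "quat_mult (0, 1, 0, 0) (0, 0, 1, 0) = (0, 0, 0, 1)"
  "quat_mult (0, 0, 1, 0) (0, 0, 0, 1) = (0, 1, 0, 0)"
  "quat_mult (0, 0, 0, 1) (0, 1, 0, 0) = (0, 0, 1, 0)"
  by simp_all

text \<open>\<open>oct_exp e \<alpha>\<close> stands for the exponential of \<open>e \<alpha>\<close>; it is meant for imaginary units \<open>e\<close> only.\<close>

definition oct_exp :: "oct \<Rightarrow> real \<Rightarrow> oct" where
  "oct_exp e \<alpha> = oct_of_real (cos \<alpha>) + sin \<alpha> *\<^sub>R e"

text \<open>The Bochner integral of an integrable octonion-valued function is the componentwise one,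
  see \<open>integral_inner_left\<close>.\<close>

definition oft :: "(real \<times> real \<times> real \<Rightarrow> oct) \<Rightarrow> real \<times> real \<times> real \<Rightarrow> oct" where
  "oft u = (\<lambda>(f1, f2, f3).
    LINT (x1, x2, x3)|lebesgue.
      u (x1, x2, x3) \<odot> oct_exp \<^bold>e\<^sub>1 (- (2 * pi * f1 * x1))
        \<odot> oct_exp \<^bold>e\<^sub>2 (- (2 * pi * f2 * x2))
        \<odot> oct_exp \<^bold>e\<^sub>4 (- (2 * pi * f3 * x3)))"

abbreviation oft_real :: "(real \<times> real \<times> real \<Rightarrow> real) \<Rightarrow> real \<times> real \<times> real \<Rightarrow> oct" where
  "oft_real u \<equiv> oft (\<lambda>x. oct_of_real (u x))"

end

theory Submission
  imports Defs
begin

text \<open>The theorem is integration by parts, combined with the rule for moving an imaginary unit to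
  the right-hand end of the octonion kernel.

  Since \<^term>\<open>u\<close> is real-valued, its transform is the integral of \<^term>\<open>u x *\<^sub>R K x\<close>, where the kernel
  \<^term>\<open>K\<close> is the product of the three exponentials. Integration by parts in the direction of one
  coordinate axis (\<open>integral_by_parts_directional\<close>) moves the derivative from \<^term>\<open>u\<close> to the kernel,
  with a minus sign, and differentiating one exponential produces a factor \<open>- 2 \<pi> f\<close> times its
  imaginary unit, located next to that exponential. This unit commutes with its own exponential and
  anticommutes with the units of the exponentials to the right of it, so pulling it to the right
  reverses the sign of the later frequencies: those of \<open>x\<^sub>2\<close> and \<open>x\<^sub>3\<close> in the first identity, that of
  \<open>x\<^sub>3\<close> in the second, none in the third. Non-associativity does not spoil this rule; it is
  checked on the eight real coordinates of the kernel (\<open>oft_kernel_derivative_1\<close> and its two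
  companions). Right multiplication by a fixed octonion is linear and hence commutes with the
  integral.

  Integration by parts has no boundary terms because the integral of a directional derivative
  vanishes as soon as the function and the derivative are integrable
  (\<open>integral_directional_derivative_eq_0\<close>). The reason is translation invariance: the increment
  \<^term>\<open>F (x + v) - F x\<close> integrates to zero, while by the fundamental theorem of calculus and
  Fubini's theorem it integrates to the integral of the derivative.\<close>

section \<open>Integrals of directional derivatives\<close>

lemma integral_lborel_translate:
  fixes f :: "'a::euclidean_space \<Rightarrow> real"
  assumes [measurable]: "f \<in> borel_measurable borel"
  shows "integral\<^sup>L lborel (\<lambda>x. f (x + c)) = integral\<^sup>L lborel f"
proof -
  have "integral\<^sup>L (distr lborel borel ((+) c)) f = integral\<^sup>L lborel (\<lambda>x. f (c + x))"
    by (rule integral_distr) auto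
  then show ?thesis
    by (simp add: lborel_distr_plus add.commute)
qed

lemma integrable_lborel_translate:
  fixes f :: "'a::euclidean_space \<Rightarrow> real"
  assumes [measurable]: "f \<in> borel_measurable borel"
  shows "integrable lborel (\<lambda>x. f (x + c)) \<longleftrightarrow> integrable lborel f"
proof -
  have "integrable (distr lborel borel ((+) c)) f \<longleftrightarrow> integrable lborel (\<lambda>x. f (c + x))"
    by (rule integrable_distr_eq) auto
  then show ?thesis
    by (simp add: lborel_distr_plus add.commute)
qed

lemma AE_lborel_translate:
  fixes c :: "'a::euclidean_space"
  assumes "AE x in lborel. P x"
  shows "AE x in lborel. P (x + c)"
proof -
  obtain N where N: "N \<in> sets lborel" "emeasure lborel N = 0" "{x. \<not> P x} \<subseteq> N"
    using assms by (auto elim!: AE_E)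
  have "AE x in lborel. x \<notin> N"
    using N by (intro AE_not_in) (auto simp: null_sets_def)
  then have "AE x in distr lborel borel ((+) c). x \<notin> N"
    unfolding lborel_distr_plus .
  then have "AE x in lborel. c + x \<notin> N"
    using N(1) by (subst (asm) AE_distr_iff) (auto simp: borel_measurable_add)
  then show ?thesis
    by (rule AE_mp) (use N(3) in \<open>auto simp: add.commute\<close>)
qed

text \<open>Fubini's theorem is about the product of Borel measures, whereas a function that is measurable
  with respect to \<^term>\<open>lebesgue\<close> is a Borel function only up to a null set; this lemma passes from one
  to the other.\<close>

lemma integrable_lebesgue_borel_representative:
  fixes f :: "'a::euclidean_space \<Rightarrow> real"
  assumes "integrable lebesgue f"
  obtains g where "g \<in> borel_measurable borel" "integrable lborel g"
    "AE x in lborel. f x = g x" "integral\<^sup>L lebesgue f = integral\<^sup>L lborel g"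
proof -
  obtain g where g: "g \<in> borel_measurable lborel" and ae: "AE x in lborel. f x = g x"
    using completion_ex_borel_measurable_real[of f lborel] assms by blast
  have ae': "AE x in lebesgue. f x = g x"
    using ae by (rule AE_completion)
  have g': "g \<in> borel_measurable lebesgue"
    using g by (rule measurable_completion)
  have "integrable lebesgue g"
    using assms g' ae' by (rule integrable_cong_AE_imp)
  then have "integrable lborel g"
    using g by (simp add: integrable_completion)
  moreover have "integral\<^sup>L lebesgue f = integral\<^sup>L lebesgue g"
    using assms g' ae' by (intro integral_cong_AE) auto
  ultimately show ?thesis
    using that g ae integral_completion[OF g] by simp
qed

text \<open>Integrating \<open>G (x + t v)\<close> over \<open>t \<in> {0..1}\<close> first gives \<open>F (x + v) - F x\<close>, whose integral over
  \<open>x\<close> is zero by translation invariance; integrating over \<open>x\<close> first gives the integral of \<open>G\<close> for every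
  \<open>t\<close>. The fundamental theorem needs the actual derivative \<open>G\<close> at every point of a segment, and
  Fubini's theorem a Borel function; these agree at almost every point of almost every segment in
  direction \<open>v\<close>, because a null set has null translates.\<close>

lemma integral_directional_derivative_eq_0:
  fixes F G :: "'a::euclidean_space \<Rightarrow> real"
  assumes F: "integrable lebesgue F" and G: "integrable lebesgue G"
    and deriv: "\<And>x. ((\<lambda>t. F (x + t *\<^sub>R v)) has_real_derivative G x) (at 0)"
  shows "integral\<^sup>L lebesgue G = 0"
proof -
  obtain F' where F'[measurable]: "F' \<in> borel_measurable borel" and F'_int: "integrable lborel F'"
    and F'_ae: "AE x in lborel. F x = F' x"
    using F by (rule integrable_lebesgue_borel_representative)
  obtain G' where G'[measurable]: "G' \<in> borel_measurable borel" and G'_int: "integrable lborel G'"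
    and G'_ae: "AE x in lborel. G x = G' x"
    and G_eq: "integral\<^sup>L lebesgue G = integral\<^sup>L lborel G'"
    using G by (rule integrable_lebesgue_borel_representative)
  define H where "H t x = indicator {0..1} t * G' (x + t *\<^sub>R v)" for t :: real and x
  have H_meas: "case_prod H \<in> borel_measurable (lborel \<Otimes>\<^sub>M lborel)"
    unfolding H_def by measurable
  have H_int: "integrable (lborel \<Otimes>\<^sub>M lborel) (case_prod H)"
  proof (rule lborel_pair.Fubini_integrable[OF H_meas])
    have "(\<integral>x. norm (H t x) \<partial>lborel) = indicator {0..1} t * (\<integral>x. norm (G' x) \<partial>lborel)" for t
      using integral_lborel_translate[of "\<lambda>x. norm (G' x)" "t *\<^sub>R v"]
      by (simp add: H_def abs_mult indicator_def)
    then show "integrable lborel (\<lambda>t. \<integral>x. norm (case_prod H (t, x)) \<partial>lborel)"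
      by simp
    show "AE t in lborel. integrable lborel (\<lambda>x. case_prod H (t, x))"
      using G'_int by (simp add: H_def integrable_lborel_translate)
  qed

  have G'_ae2: "AE x in lborel. AE t in lborel. G (x + t *\<^sub>R v) = G' (x + t *\<^sub>R v)"
  proof -
    obtain N where N[measurable]: "N \<in> sets borel" and N0: "emeasure lborel N = 0"
      and sub: "{x. G x \<noteq> G' x} \<subseteq> N"
      using G'_ae by (auto elim!: AE_E)
    have "AE x in lborel. x \<notin> N"
      using N N0 by (intro AE_not_in) (auto simp: null_sets_def)
    then have "AE t in (lborel::real measure). AE x in lborel. x + t *\<^sub>R v \<notin> N"
      by (rule AE_I2[OF AE_lborel_translate])
    then have "AE x in lborel. AE t in (lborel::real measure). x + t *\<^sub>R v \<notin> N"
      by (subst lborel_pair.AE_commute) measurable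
    then show ?thesis
      by (rule eventually_mono) (use sub in \<open>auto elim!: eventually_mono\<close>)
  qed

  have slice: "AE x in lborel. (\<integral>t. H t x \<partial>lborel) = F' (x + v) - F' x"
    using F'_ae AE_lborel_translate[OF F'_ae, of v] G'_ae2 lborel_pair.AE_integrable_snd[OF H_int]
  proof eventually_elim
    case (elim x)
    \<comment> \<open>Since \<open>G\<close> may be discontinuous, the fundamental theorem is applied to the Henstock--Kurzweil
      integral, which agrees with the Lebesgue integral on integrable functions.\<close>
    have "((\<lambda>t. F (x + t *\<^sub>R v)) has_vector_derivative G (x + t *\<^sub>R v)) (at t)" for t
      using deriv[of "x + t *\<^sub>R v"] DERIV_shift[of "\<lambda>s. F (x + s *\<^sub>R v)" _ 0 t]
      by (simp add: has_real_derivative_iff_has_vector_derivative[symmetric] algebra_simps)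
    then have "((\<lambda>t. G (x + t *\<^sub>R v)) has_integral (F (x + 1 *\<^sub>R v) - F (x + 0 *\<^sub>R v))) {0..1}"
      by (intro fundamental_theorem_of_calculus) (auto intro: has_vector_derivative_at_within)
    then have "((\<lambda>t. G' (x + t *\<^sub>R v)) has_integral (F' (x + v) - F' x)) {0..1}"
      using elim by (subst has_integral_AE[symmetric, where f="\<lambda>t. G (x + t *\<^sub>R v)"]) auto
    moreover have "(\<lambda>t. H t x) = (\<lambda>t. if t \<in> {0..1} then G' (x + t *\<^sub>R v) else 0)"
      by (auto simp: H_def)
    ultimately have "((\<lambda>t. H t x) has_integral (F' (x + v) - F' x)) UNIV"
      by (simp only: has_integral_restrict_UNIV)
    moreover have "((\<lambda>t. H t x) has_integral (\<integral>t. H t x \<partial>lborel)) UNIV"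
      using elim by (intro has_integral_integral_lborel) simp
    ultimately show ?case
      by (rule has_integral_unique[symmetric])
  qed

  have "integral\<^sup>L lborel G' = (\<integral>t. indicator {0..1} t * integral\<^sup>L lborel G' \<partial>(lborel::real measure))"
    by simp
  also have "\<dots> = (\<integral>t. (\<integral>x. H t x \<partial>lborel) \<partial>lborel)"
    by (simp add: H_def integral_lborel_translate)
  also have "\<dots> = (\<integral>x. (\<integral>t. H t x \<partial>lborel) \<partial>lborel)"
    using H_int by (rule lborel_pair.Fubini_integral[symmetric])
  also have "\<dots> = (\<integral>x. F' (x + v) - F' x \<partial>lborel)"
    using slice H_meas by (intro integral_cong_AE) (measurable, auto)
  also have "\<dots> = 0"
    using F'_int by (simp add: integral_lborel_translate integrable_lborel_translate)
  finally show ?thesis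
    using G_eq by simp
qed

lemma integrable_scaleR_bounded_continuous:
  fixes u :: "'a::euclidean_space \<Rightarrow> real" and K :: "'a \<Rightarrow> 'b::euclidean_space"
  assumes "integrable lebesgue u" "continuous_on UNIV K" "bounded (range K)"
  shows "integrable lebesgue (\<lambda>x. u x *\<^sub>R K x)"
proof -
  obtain B where B: "\<And>x. norm (K x) \<le> B"
    using assms(3) by (auto simp: bounded_iff)
  have "K \<in> borel_measurable lebesgue"
    using assms(2) by (intro measurable_completion) (simp add: borel_measurable_continuous_onI)
  then have meas: "(\<lambda>x. u x *\<^sub>R K x) \<in> borel_measurable lebesgue"
    by (rule borel_measurable_scaleR[OF borel_measurable_integrable[OF assms(1)]])
  have bound: "norm (u x *\<^sub>R K x) \<le> norm (u x * B)" for x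
    using mult_left_mono[OF order_trans[OF B abs_ge_self], of "\<bar>u x\<bar>" x]
    by (simp add: abs_mult)
  show ?thesis
    by (rule Bochner_Integration.integrable_bound[OF integrable_mult_left meas AE_I2[OF bound]])
      (rule assms(1))
qed

text \<open>Each coordinate of \<open>u *\<^sub>R K\<close> is integrable, and so is its directional derivative, given by the
  product rule; hence the integral of this derivative vanishes.\<close>

lemma integral_by_parts_directional:
  fixes u w :: "'a::euclidean_space \<Rightarrow> real" and K K' :: "'a \<Rightarrow> 'b::euclidean_space"
  assumes u: "integrable lebesgue u" and w: "integrable lebesgue w"
    and du: "\<And>x. ((\<lambda>t. u (x + t *\<^sub>R v)) has_real_derivative w x) (at 0)"
    and K: "continuous_on UNIV K" "bounded (range K)"
    and K': "continuous_on UNIV K'" "bounded (range K')"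
    and dK: "\<And>x. ((\<lambda>t. K (x + t *\<^sub>R v)) has_vector_derivative K' x) (at 0)"
  shows "(\<integral>x. w x *\<^sub>R K x \<partial>lebesgue) = - (\<integral>x. u x *\<^sub>R K' x \<partial>lebesgue)"
proof (rule euclidean_eqI)
  fix b :: 'b
  note int = integrable_scaleR_bounded_continuous[OF u K] integrable_scaleR_bounded_continuous[OF w K]
    integrable_scaleR_bounded_continuous[OF u K']
  have "integral\<^sup>L lebesgue (\<lambda>x. (w x *\<^sub>R K x) \<bullet> b + (u x *\<^sub>R K' x) \<bullet> b) = 0"
  proof (rule integral_directional_derivative_eq_0)
    show "integrable lebesgue (\<lambda>x. (u x *\<^sub>R K x) \<bullet> b)"
      "integrable lebesgue (\<lambda>x. (w x *\<^sub>R K x) \<bullet> b + (u x *\<^sub>R K' x) \<bullet> b)"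
      by (intro Bochner_Integration.integrable_add integrable_inner_left int)+
    fix x
    have "((\<lambda>t. K (x + t *\<^sub>R v) \<bullet> b) has_real_derivative K' x \<bullet> b) (at 0)"
      using bounded_linear.has_vector_derivative[OF bounded_linear_inner_left dK[of x]]
      by (simp add: has_real_derivative_iff_has_vector_derivative)
    from DERIV_mult[OF du[of x] this]
    show "((\<lambda>t. (u (x + t *\<^sub>R v) *\<^sub>R K (x + t *\<^sub>R v)) \<bullet> b)
        has_real_derivative (w x *\<^sub>R K x) \<bullet> b + (u x *\<^sub>R K' x) \<bullet> b) (at 0)"
      by (simp add: algebra_simps)
  qed
  then show "(\<integral>x. w x *\<^sub>R K x \<partial>lebesgue) \<bullet> b = (- (\<integral>x. u x *\<^sub>R K' x \<partial>lebesgue)) \<bullet> b"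
    unfolding Bochner_Integration.integral_add[OF integrable_inner_left integrable_inner_left, OF int(2,3)]
      integral_inner_left[OF int(2)] integral_inner_left[OF int(3)] by simp
qed

section \<open>The octonion Fourier kernel\<close>

definition oft_kernel :: "real \<times> real \<times> real \<Rightarrow> real \<times> real \<times> real \<Rightarrow> oct" where
  "oft_kernel = (\<lambda>(f1, f2, f3) (x1, x2, x3).
    oct_exp \<^bold>e\<^sub>1 (- (2 * pi * f1 * x1)) \<odot> oct_exp \<^bold>e\<^sub>2 (- (2 * pi * f2 * x2))
      \<odot> oct_exp \<^bold>e\<^sub>4 (- (2 * pi * f3 * x3)))"

lemmas oct_simps = oct_exp_def oct_of_real_def oct_e1_def oct_e2_def oct_e4_def zero_prod_def

lemma oct_exp_unit_coordinates:
  "oct_exp \<^bold>e\<^sub>1 a = ((cos a, sin a, 0, 0), 0, 0, 0, 0)"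
  "oct_exp \<^bold>e\<^sub>2 a = ((cos a, 0, sin a, 0), 0, 0, 0, 0)"
  "oct_exp \<^bold>e\<^sub>4 a = ((cos a, 0, 0, 0), sin a, 0, 0, 0)"
  by (simp_all add: oct_simps)

lemma oft_kernel_coordinates:
  "oft_kernel (f1, f2, f3) (x1, x2, x3) =
    (let a = 2 * pi * f1 * x1; b = 2 * pi * f2 * x2; c = 2 * pi * f3 * x3 in
    ((cos a * cos b * cos c, - sin a * cos b * cos c,
      - cos a * sin b * cos c, sin a * sin b * cos c),
     (- cos a * cos b * sin c, sin a * cos b * sin c,
      cos a * sin b * sin c, - sin a * sin b * sin c)))"
  by (simp add: oft_kernel_def oct_exp_unit_coordinates Let_def)

lemma quat_mult_bilinear:
  "quat_mult (p + q) r = quat_mult p r + quat_mult q r"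
  "quat_mult r (p + q) = quat_mult r p + quat_mult r q"
  "quat_mult (a *\<^sub>R p) r = a *\<^sub>R quat_mult p r"
  "quat_mult r (a *\<^sub>R p) = a *\<^sub>R quat_mult r p"
  by (cases p; cases q; cases r; simp add: algebra_simps)+

lemma bounded_linear_oct_mult_left: "bounded_linear (\<lambda>y. y \<odot> c)"
  unfolding linear_conv_bounded_linear[symmetric]
proof (rule linearI)
  show "(x + y) \<odot> c = x \<odot> c + y \<odot> c" for x y
    by (cases x rule: prod.exhaust; cases y rule: prod.exhaust; cases c rule: prod.exhaust)
      (simp add: quat_mult_bilinear)
  show "(r *\<^sub>R x) \<odot> c = r *\<^sub>R (x \<odot> c)" for r x
    by (cases x rule: prod.exhaust; cases c rule: prod.exhaust)
      (simp add: quat_mult_bilinear scaleR_add_right scaleR_diff_right)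
qed

lemma oft_real_eq_integral_kernel:
  "oft_real u f = (\<integral>x. u x *\<^sub>R oft_kernel f x \<partial>lebesgue)"
proof -
  have "oct_of_real r \<odot> p = r *\<^sub>R p" for r p
    by (cases p) (auto simp: oct_of_real_def zero_prod_def)
  then have "oct_of_real r \<odot> p \<odot> q \<odot> s = r *\<^sub>R (p \<odot> q \<odot> s)" for r p q s
    using linear_cmul[OF bounded_linear.linear[OF bounded_linear_oct_mult_left]] by simp
  then have "(\<lambda>x. u x *\<^sub>R oft_kernel (f1, f2, f3) x) = (\<lambda>(x1, x2, x3). oct_of_real (u (x1, x2, x3))
      \<odot> oct_exp \<^bold>e\<^sub>1 (- (2 * pi * f1 * x1)) \<odot> oct_exp \<^bold>e\<^sub>2 (- (2 * pi * f2 * x2))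
      \<odot> oct_exp \<^bold>e\<^sub>4 (- (2 * pi * f3 * x3)))" for f1 f2 f3
    by (simp add: fun_eq_iff oft_kernel_def)
  then show ?thesis
    by (cases f) (simp add: oft_def)
qed

lemma continuous_on_oft_kernel: "continuous_on UNIV (oft_kernel f)"
proof -
  obtain f1 f2 f3 where f: "f = (f1, f2, f3)"
    by (cases f)
  have "continuous_on UNIV (\<lambda>x. oft_kernel f (fst x, fst (snd x), snd (snd x)))"
    unfolding f oft_kernel_coordinates Let_def by (intro continuous_intros)
  then show ?thesis
    by simp
qed

lemma bounded_oft_kernel: "bounded (range (oft_kernel f))"
proof -
  have abs1: "\<bar>p * q * r\<bar> \<le> 1" if "\<bar>p\<bar> \<le> 1" "\<bar>q\<bar> \<le> 1" "\<bar>r\<bar> \<le> 1" for p q r :: real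
    using that by (simp add: abs_mult mult_le_one)
  have quat_bound: "norm (p, q, r, s) \<le> 4"
    if "\<bar>p\<bar> \<le> 1" "\<bar>q\<bar> \<le> 1" "\<bar>r\<bar> \<le> 1" "\<bar>s\<bar> \<le> 1" for p q r s :: real
    using that norm_Pair_le[of p "(q, r, s)"] norm_Pair_le[of q "(r, s)"] norm_Pair_le[of r s]
    by simp
  have oct_bound: "norm (p, q) \<le> 8" if "norm p \<le> 4" "norm q \<le> 4" for p q :: quat
    using that norm_Pair_le[of p q] by simp
  have "norm (oft_kernel f x) \<le> 8" for x
    by (cases f; cases x; simp only: oft_kernel_coordinates Let_def;
        intro oct_bound quat_bound) (auto intro!: abs1)
  then show ?thesis
    by (auto simp: bounded_iff)
qed

text \<open>These three lemmas are the algebraic core: the unit produced by differentiating one exponential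
  is moved to the right-hand end of the product, where it has reversed the frequencies of the
  exponentials that it has passed. Because the octonions are not associative, this is not a formal
  consequence of \<open>\<^bold>e\<^sub>1\<close>, \<open>\<^bold>e\<^sub>2\<close> and \<open>\<^bold>e\<^sub>4\<close> anticommuting, and it is read off from the coordinates.\<close>

lemma oft_kernel_derivative_1:
  "((\<lambda>t. oft_kernel (f1, f2, f3) (x + t *\<^sub>R (1, 0, 0))) has_vector_derivative
     - (oft_kernel (f1, - f2, - f3) x \<odot> ((2 * pi * f1) *\<^sub>R \<^bold>e\<^sub>1))) (at 0)"
  by (cases x) (auto simp: oft_kernel_coordinates Let_def oct_simps
      simp flip: has_real_derivative_iff_has_vector_derivative
      intro!: has_vector_derivative_Pair derivative_eq_intros)

lemma oft_kernel_derivative_2: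
  "((\<lambda>t. oft_kernel (f1, f2, f3) (x + t *\<^sub>R (0, 1, 0))) has_vector_derivative
     - (oft_kernel (f1, f2, - f3) x \<odot> ((2 * pi * f2) *\<^sub>R \<^bold>e\<^sub>2))) (at 0)"
  by (cases x) (auto simp: oft_kernel_coordinates Let_def oct_simps
      simp flip: has_real_derivative_iff_has_vector_derivative
      intro!: has_vector_derivative_Pair derivative_eq_intros)

lemma oft_kernel_derivative_3:
  "((\<lambda>t. oft_kernel (f1, f2, f3) (x + t *\<^sub>R (0, 0, 1))) has_vector_derivative
     - (oft_kernel (f1, f2, f3) x \<odot> ((2 * pi * f3) *\<^sub>R \<^bold>e\<^sub>4))) (at 0)"
  by (cases x) (auto simp: oft_kernel_coordinates Let_def oct_simps
      simp flip: has_real_derivative_iff_has_vector_derivative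
      intro!: has_vector_derivative_Pair derivative_eq_intros)

section \<open>The transform of a partial derivative\<close>

text \<open>The part of the argument common to the three axes: \<open>f\<close> is the frequency of the transformed
  derivative, \<open>g\<close> the frequency with the signs reversed by moving the unit to the right, and \<open>c\<close> that
  unit times \<open>2 \<pi>\<close> and the frequency of the differentiated variable.\<close>

lemma oft_real_directional_derivative:
  assumes u: "integrable lebesgue u" and w: "integrable lebesgue w"
    and du: "\<And>x. ((\<lambda>t. u (x + t *\<^sub>R v)) has_real_derivative w x) (at 0)"
    and dK: "\<And>x. ((\<lambda>t. oft_kernel f (x + t *\<^sub>R v)) has_vector_derivative
      - (oft_kernel g x \<odot> c)) (at 0)"
  shows "oft_real w f = oft_real u g \<odot> c"
proof -
  interpret T: bounded_linear "\<lambda>y. y \<odot> c"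
    by (rule bounded_linear_oct_mult_left)
  have "oft_real w f = - (\<integral>x. u x *\<^sub>R - (oft_kernel g x \<odot> c) \<partial>lebesgue)"
    unfolding oft_real_eq_integral_kernel
  proof (rule integral_by_parts_directional[OF u w du _ _ _ _ dK])
    show "continuous_on UNIV (\<lambda>x. - (oft_kernel g x \<odot> c))"
      by (intro continuous_intros T.continuous_on continuous_on_oft_kernel)
    have "bounded ((\<lambda>y. - (y \<odot> c)) ` range (oft_kernel g))"
      by (rule bounded_linear_image[OF bounded_oft_kernel bounded_linear_minus])
        (rule T.bounded_linear_axioms)
    then show "bounded (range (\<lambda>x. - (oft_kernel g x \<odot> c)))"
      by (simp add: image_image)
  qed (simp_all add: continuous_on_oft_kernel bounded_oft_kernel)
  also have "\<dots> = (\<integral>x. (u x *\<^sub>R oft_kernel g x) \<odot> c \<partial>lebesgue)"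
    by (simp add: T.scaleR)
  also have "\<dots> = oft_real u g \<odot> c"
    unfolding oft_real_eq_integral_kernel
    by (intro integral_bounded_linear T.bounded_linear_axioms integrable_scaleR_bounded_continuous
        u continuous_on_oft_kernel bounded_oft_kernel)
  finally show ?thesis .
qed

theorem theorem14:
  fixes u u1 u2 u3 :: "real \<times> real \<times> real \<Rightarrow> real"
  assumes "integrable lebesgue u"
    and "\<And>x1 x2 x3. ((\<lambda>t. u (t, x2, x3)) has_real_derivative u1 (x1, x2, x3)) (at x1)"
    and "\<And>x1 x2 x3. ((\<lambda>t. u (x1, t, x3)) has_real_derivative u2 (x1, x2, x3)) (at x2)"
    and "\<And>x1 x2 x3. ((\<lambda>t. u (x1, x2, t)) has_real_derivative u3 (x1, x2, x3)) (at x3)"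
    and "integrable lebesgue u1"
    and "integrable lebesgue u2"
    and "integrable lebesgue u3"
  shows "\<forall>f1 f2 f3.
      oft_real u1 (f1, f2, f3) = oft_real u (f1, - f2, - f3) \<odot> ((2 * pi * f1) *\<^sub>R \<^bold>e\<^sub>1) \<and>
      oft_real u2 (f1, f2, f3) = oft_real u (f1, f2, - f3) \<odot> ((2 * pi * f2) *\<^sub>R \<^bold>e\<^sub>2) \<and>
      oft_real u3 (f1, f2, f3) = oft_real u (f1, f2, f3) \<odot> ((2 * pi * f3) *\<^sub>R \<^bold>e\<^sub>4)"
proof (intro allI conjI)
  fix f1 f2 f3
  have shift: "((\<lambda>t. h (a + t)) has_real_derivative D) (at 0)"
    if "(h has_real_derivative D) (at a)" for h D and a :: real
    using that DERIV_shift[of h D 0 a] by (simp add: add.commute)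
  have d1: "((\<lambda>t. u (x + t *\<^sub>R (1, 0, 0))) has_real_derivative u1 x) (at 0)" for x
    by (cases x) (simp add: shift[OF assms(2)])
  have d2: "((\<lambda>t. u (x + t *\<^sub>R (0, 1, 0))) has_real_derivative u2 x) (at 0)" for x
    by (cases x) (simp add: shift[OF assms(3)])
  have d3: "((\<lambda>t. u (x + t *\<^sub>R (0, 0, 1))) has_real_derivative u3 x) (at 0)" for x
    by (cases x) (simp add: shift[OF assms(4)])
  show "oft_real u1 (f1, f2, f3) = oft_real u (f1, - f2, - f3) \<odot> ((2 * pi * f1) *\<^sub>R \<^bold>e\<^sub>1)"
    using assms(1,5) d1 oft_kernel_derivative_1 by (rule oft_real_directional_derivative)
  show "oft_real u2 (f1, f2, f3) = oft_real u (f1, f2, - f3) \<odot> ((2 * pi * f2) *\<^sub>R \<^bold>e\<^sub>2)"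
    using assms(1,6) d2 oft_kernel_derivative_2 by (rule oft_real_directional_derivative)
  show "oft_real u3 (f1, f2, f3) = oft_real u (f1, f2, f3) \<odot> ((2 * pi * f3) *\<^sub>R \<^bold>e\<^sub>4)"
    using assms(1,7) d3 oft_kernel_derivative_3 by (rule oft_real_directional_derivative)
qed

end
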